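(* Consider the public-good problem with two taxpayers holding $k$-bit private values $x_1,x_2\in\{0,\ldots,2^k-1\}$ and cost $c=2^k-1$ (build if and only if $x_1+x_2\ge c$). Then $\hat{x}_2=c-x_2$ is again a $k$-bit value, and $x_1+x_2\ge c$ if and only if $x_1\ge \hat{x}_2$; from the perspective of privacy-approximation ratios, this problem is equivalent to solving the Millionaires Problem on inputs $x_1$ and $\hat{x}_2$. Consequently, the public-good problem with $c=2^k-1$ has exponential (in $k$) average-case objective privacy-approximation ratio with respect to the uniform distribution.
   Context: Communication model. Parties $1$ and $2$ hold private inputs $x_1,x_2\in\{0,\ldots,2^k-1\}$ (each a $k$-bit string). In a deterministic communication protocol $P$ the parties exchange bits; the history of bits sent so far determines whose turn it is, and each bit is a function of the sender's own input and the history. The sequence of all bits sent on input $(x_1,x_2)$ is the transcript. $P$ is a protocol for a function $f$ if it computes $f(x_1,x_2)$ on every input $(x_1,x_2)$ (the last message contains this value). Let $R^P(x_1,x_2)$ be the set of all inputs having the same transcript as $(x_1,x_2)$; it is a combinatorial rectangle on which $f$ is constant. Let $R^I(x_1,x_2)=\{(x_1',x_2'): f(x_1',x_2')=f(x_1,x_2)\}$. For $i\in\{1,2\}$ let $R_i^P(x_1,x_2)$ and $R_i^I(x_1,x_2)$ be the sets of elements of $R^P(x_1,x_2)$ and $R^I(x_1,x_2)$, respectively, whose $i$-th coordinate is $x_i$. Privacy-approximation ratios (PARs). The worst-case objective PAR of $P$ is the maximum over inputs of $|R^I(x_1,x_2)|/|R^P(x_1,x_2)|$; the average-case objective PAR of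 $P$ with respect to a probability distribution $D$ on inputs is the expectation of this ratio under $D$. The worst-case (average-case) PAR of $P$ with respect to $i$ is defined in the same way using $|R_i^I(x_1,x_2)|/|R_i^P(x_1,x_2)|$, and the subjective PAR of $P$ is the maximum over $i\in\{1,2\}$ of the PAR with respect to $i$. Each PAR of a function $f$ is the minimum of the corresponding PAR over all protocols $P$ for $f$. Millionaires Problem: on inputs $x_1,x_2\in\{0,\ldots,2^k-1\}$, output the identity of the party with the higher value, ties being broken in favor of party $1$ (so the output is $1$ if $x_1\ge x_2$ and $2$ otherwise). Public-good problem with cost $c=2^k-1$: output "Build" if $x_1+x_2\ge 2^k-1$ and "Do Not Build" otherwise. The uniform distribution is the uniform distribution on $\{0,\ldots,2^k-1\}^2$. *)

theory Defs
  imports "HOL-Probability.Probability" "HOL-Library.Landau_Symbols"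
begin

datatype party = Party1 | Party2

fun coord :: "party \<Rightarrow> nat \<times> nat \<Rightarrow> nat" where
  "coord Party1 (x1, x2) = x1"
| "coord Party2 (x1, x2) = x2"

definition inputs :: "nat \<Rightarrow> (nat \<times> nat) set" where
  "inputs k = {0..2 ^ k - 1} \<times> {0..2 ^ k - 1}"

text \<open>
  A protocol is a finite binary tree whose nodes are the possible histories.  In
  \<open>Send i m next\<close> it is the turn of party \<open>i\<close>, who sends the bit \<open>m x\<close>, where \<open>x\<close> is
  that party's own input; the protocol then continues with \<open>next (m x)\<close>.
\<close>

datatype protocol = Halt | Send party "nat \<Rightarrow> bool" "bool \<Rightarrow> protocol"

primrec history :: "protocol \<Rightarrow> nat \<times> nat \<Rightarrow> (party \<times> bool) list" where
  "history Halt x = []"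
| "history (Send i m next) x = (i, m (coord i x)) # history (next (m (coord i x))) x"

definition transcript :: "protocol \<Rightarrow> nat \<times> nat \<Rightarrow> bool list" where
  "transcript P x = map snd (history P x)"

text \<open>A message is a maximal block of consecutive bits from the same sender.\<close>

definition last_message :: "(party \<times> bool) list \<Rightarrow> bool list" where
  "last_message h = map snd (rev (takeWhile (\<lambda>s. fst s = fst (last h)) (rev h)))"

text \<open>
  The last message contains the value of \<open>f\<close> if that value can be decoded from the last
  message alone.
\<close>

definition protocols_for :: "nat \<Rightarrow> (nat \<times> nat \<Rightarrow> 'o) \<Rightarrow> protocol set" where
  "protocols_for k f = {P. \<exists>decode. \<forall>x\<in>inputs k.
     history P x \<noteq> [] \<and> decode (last_message (history P x)) = f x}"

definition RP :: "nat \<Rightarrow> protocol \<Rightarrow> nat \<times> nat \<Rightarrow> (nat \<times> nat) set" where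
  "RP k P x = {y \<in> inputs k. transcript P y = transcript P x}"

definition RI :: "nat \<Rightarrow> (nat \<times> nat \<Rightarrow> 'o) \<Rightarrow> nat \<times> nat \<Rightarrow> (nat \<times> nat) set" where
  "RI k f x = {y \<in> inputs k. f y = f x}"

definition RP_wrt :: "party \<Rightarrow> nat \<Rightarrow> protocol \<Rightarrow> nat \<times> nat \<Rightarrow> (nat \<times> nat) set" where
  "RP_wrt i k P x = {y \<in> RP k P x. coord i y = coord i x}"

definition RI_wrt :: "party \<Rightarrow> nat \<Rightarrow> (nat \<times> nat \<Rightarrow> 'o) \<Rightarrow> nat \<times> nat \<Rightarrow> (nat \<times> nat) set" where
  "RI_wrt i k f x = {y \<in> RI k f x. coord i y = coord i x}"

definition ratio_obj :: "nat \<Rightarrow> (nat \<times> nat \<Rightarrow> 'o) \<Rightarrow> protocol \<Rightarrow> nat \<times> nat \<Rightarrow> real" where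
  "ratio_obj k f P x = real (card (RI k f x)) / real (card (RP k P x))"

definition ratio_wrt ::
    "party \<Rightarrow> nat \<Rightarrow> (nat \<times> nat \<Rightarrow> 'o) \<Rightarrow> protocol \<Rightarrow> nat \<times> nat \<Rightarrow> real" where
  "ratio_wrt i k f P x = real (card (RI_wrt i k f x)) / real (card (RP_wrt i k P x))"

subsection \<open>Privacy-approximation ratios of a protocol\<close>

definition worst_obj_PAR :: "nat \<Rightarrow> (nat \<times> nat \<Rightarrow> 'o) \<Rightarrow> protocol \<Rightarrow> real" where
  "worst_obj_PAR k f P = Max (ratio_obj k f P ` inputs k)"

definition avg_obj_PAR ::
    "nat \<Rightarrow> (nat \<times> nat) pmf \<Rightarrow> (nat \<times> nat \<Rightarrow> 'o) \<Rightarrow> protocol \<Rightarrow> real" where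
  "avg_obj_PAR k D f P = measure_pmf.expectation D (ratio_obj k f P)"

definition worst_PAR_wrt :: "party \<Rightarrow> nat \<Rightarrow> (nat \<times> nat \<Rightarrow> 'o) \<Rightarrow> protocol \<Rightarrow> real" where
  "worst_PAR_wrt i k f P = Max (ratio_wrt i k f P ` inputs k)"

definition avg_PAR_wrt ::
    "party \<Rightarrow> nat \<Rightarrow> (nat \<times> nat) pmf \<Rightarrow> (nat \<times> nat \<Rightarrow> 'o) \<Rightarrow> protocol \<Rightarrow> real" where
  "avg_PAR_wrt i k D f P = measure_pmf.expectation D (ratio_wrt i k f P)"

definition worst_subj_PAR :: "nat \<Rightarrow> (nat \<times> nat \<Rightarrow> 'o) \<Rightarrow> protocol \<Rightarrow> real" where
  "worst_subj_PAR k f P = max (worst_PAR_wrt Party1 k f P) (worst_PAR_wrt Party2 k f P)"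

definition avg_subj_PAR ::
    "nat \<Rightarrow> (nat \<times> nat) pmf \<Rightarrow> (nat \<times> nat \<Rightarrow> 'o) \<Rightarrow> protocol \<Rightarrow> real" where
  "avg_subj_PAR k D f P = max (avg_PAR_wrt Party1 k D f P) (avg_PAR_wrt Party2 k D f P)"

subsection \<open>Privacy-approximation ratios of a function\<close>

text \<open>
  For fixed \<open>k\<close>, \<open>f\<close> and \<open>D\<close> with support in \<open>inputs k\<close>, each of the ratios above takes
  only finitely many values, since it depends only on the partition of \<open>inputs k\<close> induced by
  the protocol.  The infimum below is therefore a minimum.
\<close>

definition min_PAR ::
    "nat \<Rightarrow> (nat \<times> nat \<Rightarrow> 'o) \<Rightarrow> ((nat \<times> nat \<Rightarrow> 'o) \<Rightarrow> protocol \<Rightarrow> real) \<Rightarrow> real" where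
  "min_PAR k f PAR = (INF P\<in>protocols_for k f. PAR f P)"

definition fun_worst_obj_PAR :: "nat \<Rightarrow> (nat \<times> nat \<Rightarrow> 'o) \<Rightarrow> real" where
  "fun_worst_obj_PAR k f = min_PAR k f (worst_obj_PAR k)"

definition fun_avg_obj_PAR :: "nat \<Rightarrow> (nat \<times> nat) pmf \<Rightarrow> (nat \<times> nat \<Rightarrow> 'o) \<Rightarrow> real" where
  "fun_avg_obj_PAR k D f = min_PAR k f (avg_obj_PAR k D)"

definition fun_worst_PAR_wrt :: "party \<Rightarrow> nat \<Rightarrow> (nat \<times> nat \<Rightarrow> 'o) \<Rightarrow> real" where
  "fun_worst_PAR_wrt i k f = min_PAR k f (worst_PAR_wrt i k)"

definition fun_avg_PAR_wrt ::
    "party \<Rightarrow> nat \<Rightarrow> (nat \<times> nat) pmf \<Rightarrow> (nat \<times> nat \<Rightarrow> 'o) \<Rightarrow> real" where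
  "fun_avg_PAR_wrt i k D f = min_PAR k f (avg_PAR_wrt i k D)"

definition fun_worst_subj_PAR :: "nat \<Rightarrow> (nat \<times> nat \<Rightarrow> 'o) \<Rightarrow> real" where
  "fun_worst_subj_PAR k f = min_PAR k f (worst_subj_PAR k)"

definition fun_avg_subj_PAR :: "nat \<Rightarrow> (nat \<times> nat) pmf \<Rightarrow> (nat \<times> nat \<Rightarrow> 'o) \<Rightarrow> real" where
  "fun_avg_subj_PAR k D f = min_PAR k f (avg_subj_PAR k D)"

subsection \<open>The two problems\<close>

fun millionaires :: "nat \<times> nat \<Rightarrow> party" where
  "millionaires (x1, x2) = (if x1 \<ge> x2 then Party1 else Party2)"

datatype decision = Build | Do_Not_Build

fun public_good :: "nat \<Rightarrow> nat \<times> nat \<Rightarrow> decision" where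
  "public_good c (x1, x2) = (if x1 + x2 \<ge> c then Build else Do_Not_Build)"

definition cost :: "nat \<Rightarrow> nat" where
  "cost k = 2 ^ k - 1"

text \<open>On \<open>inputs k\<close> we have \<open>x2 \<le> cost k\<close>, so the subtraction does not truncate.\<close>

fun flip :: "nat \<Rightarrow> nat \<times> nat \<Rightarrow> nat \<times> nat" where
  "flip k (x1, x2) = (x1, cost k - x2)"

definition uniform :: "nat \<Rightarrow> (nat \<times> nat) pmf" where
  "uniform k = pmf_of_set (inputs k)"

end

theory Submission
  imports Defs
begin

text \<open>
  Composing the messages of party 2 with \<open>x \<mapsto> c - x\<close> turns a protocol for one problem into one
  for the other without changing any transcript, so every ratio is preserved.  Averaging
  \<open>|R\<^sup>I| / |R\<^sup>P|\<close> over a set that is a union of transcript classes counts these classes, weighted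
  by \<open>|R\<^sup>I|\<close>; hence, with \<open>N = 2^k\<close>, the uniform average is of the order of the number of
  transcripts.  For the Millionaires Problem the \<open>N\<close> diagonal inputs have pairwise different
  transcripts (two equal ones would span a rectangle containing both outputs), and searching for
  the minimum of the two inputs by a linear scan uses only \<open>2 N + 1\<close> transcripts.
\<close>

section \<open>Transcripts\<close>

text \<open>A transcript omits the senders, but the bits sent so far fix the node reached in the
  tree and hence who speaks next.\<close>

lemma history_eq_if_transcript_eq:
  "transcript P x = transcript P y \<Longrightarrow> history P x = history P y"
  by (induction P) (auto simp: transcript_def)

text \<open>Each bit depends on one coordinate only: on the mixed input, party 1 acts as in the
  first run and party 2 as in the second, and both runs follow \<open>h\<close>.\<close>

lemma history_rectangle:
  "history P (x1, x2) = h \<Longrightarrow> history P (y1, y2) = h \<Longrightarrow> history P (x1, y2) = h"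
proof (induction P arbitrary: h)
  case Halt
  then show ?case by simp
next
  case (Send i m P')
  then show ?case by (cases i) auto
qed

text \<open>Lets a decoder that sees only the last message recover the last bit, which is where
  \<open>scan\<close> puts its answer.\<close>

lemma last_last_message:
  assumes "h \<noteq> []"
  shows "last (last_message h) = snd (last h)"
proof -
  obtain h' a where h: "h = h' @ [a]"
    using assms by (cases h rule: rev_cases) auto
  show ?thesis
    by (simp add: last_message_def h)
qed

lemma output_eq_if_transcript_eq:
  assumes "P \<in> protocols_for k f" "x \<in> inputs k" "y \<in> inputs k" "transcript P x = transcript P y"
  shows "f x = f y"
proof -
  obtain decode where "\<forall>x\<in>inputs k. decode (last_message (history P x)) = f x"
    using assms(1) by (auto simp: protocols_for_def)
  then show ?thesis
    using assms(2,3) history_eq_if_transcript_eq[OF assms(4)] by metis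
qed

lemma finite_inputs [simp]: "finite (inputs k)"
  and inputs_nonempty [simp]: "inputs k \<noteq> {}"
  by (auto simp: inputs_def)

lemma card_inputs: "card (inputs k) = 2 ^ k * 2 ^ k"
  by (simp add: inputs_def)

section \<open>Equivalence of the two problems\<close>

declare flip.simps [simp del]

lemma flip_in_inputs: "x \<in> inputs k \<Longrightarrow> flip k x \<in> inputs k"
  by (cases x) (auto simp: flip.simps inputs_def cost_def)

lemma flip_flip: "x \<in> inputs k \<Longrightarrow> flip k (flip k x) = x"
  by (cases x) (auto simp: flip.simps inputs_def cost_def)

lemma bij_betw_flip: "bij_betw (flip k) (inputs k) (inputs k)"
  by (rule bij_betw_byWitness[where f' = "flip k"]) (auto simp: flip_flip flip_in_inputs)

lemma coord_flip_eq_iff: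
  "x \<in> inputs k \<Longrightarrow> y \<in> inputs k \<Longrightarrow>
    coord i (flip k y) = coord i (flip k x) \<longleftrightarrow> coord i y = coord i x"
  by (cases x; cases y; cases i) (auto simp: flip.simps inputs_def cost_def)

section \<open>Transport of protocols along the flip\<close>

text \<open>Local preprocessing of inputs: the tree keeps its shape, so a run on one input repeats
  the original run on another.\<close>

primrec relabel :: "(party \<Rightarrow> nat \<Rightarrow> nat) \<Rightarrow> protocol \<Rightarrow> protocol" where
  "relabel g Halt = Halt"
| "relabel g (Send i m next) = Send i (m \<circ> g i) (\<lambda>b. relabel g (next b))"

lemma history_relabel:
  assumes "\<And>i. coord i y = g i (coord i x)"
  shows "history (relabel g P) x = history P y"
  by (induction P) (simp_all add: assms)

definition flip_protocol :: "nat \<Rightarrow> protocol \<Rightarrow> protocol" where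
  "flip_protocol k = relabel (\<lambda>i x. case i of Party1 \<Rightarrow> x | Party2 \<Rightarrow> cost k - x)"

lemma history_flip_protocol: "history (flip_protocol k P) x = history P (flip k x)"
  unfolding flip_protocol_def
proof (rule history_relabel)
  fix i show "coord i (flip k x) = (case i of Party1 \<Rightarrow> coord i x | Party2 \<Rightarrow> cost k - coord i x)"
    by (cases x; cases i) (simp_all add: flip.simps)
qed

text \<open>The common source of all equalities between PARs. The output types may differ, since
  only the partitions induced by the functions matter.\<close>

definition same_privacy ::
    "nat \<Rightarrow> (nat \<times> nat \<Rightarrow> 'a) \<Rightarrow> protocol \<Rightarrow> (nat \<times> nat \<Rightarrow> 'b) \<Rightarrow> protocol \<Rightarrow> bool" where
  "same_privacy k f Q g P \<longleftrightarrow> (\<forall>x\<in>inputs k.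
     transcript Q (flip k x) = transcript P x \<and>
     ratio_obj k f Q (flip k x) = ratio_obj k g P x \<and>
     (\<forall>i. ratio_wrt i k f Q (flip k x) = ratio_wrt i k g P x))"

text \<open>\<open>flip k\<close> is an involution on \<open>inputs k\<close>, so it restricts to a
  bijection between the two sets.\<close>

lemma card_Collect_flip:
  "card {y \<in> inputs k. p (flip k y)} = card {y \<in> inputs k. p y}"
proof (rule bij_betw_same_card)
  show "bij_betw (flip k) {y \<in> inputs k. p (flip k y)} {y \<in> inputs k. p y}"
    by (rule bij_betw_byWitness[where f' = "flip k"]) (auto simp: flip_flip flip_in_inputs)
qed

text \<open>Once the counted inputs are written as \<open>flip k y\<close>, the regions of
  \<open>flip k x\<close> are described by agreements between flipped inputs, which the assumptions
  turn into agreements between \<open>y\<close> and \<open>x\<close>.\<close>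

lemma same_privacyI:
  assumes "\<And>x. x \<in> inputs k \<Longrightarrow> transcript Q (flip k x) = transcript P x"
    and "\<And>x y. x \<in> inputs k \<Longrightarrow> y \<in> inputs k \<Longrightarrow> f (flip k y) = f (flip k x) \<longleftrightarrow> g y = g x"
  shows "same_privacy k f Q g P"
  unfolding same_privacy_def
proof (intro ballI conjI allI)
  fix x assume x: "x \<in> inputs k"
  show "transcript Q (flip k x) = transcript P x"
    using assms(1) x .
  have "card (RI k f (flip k x)) = card {y \<in> inputs k. f (flip k y) = f (flip k x)}"
    unfolding RI_def card_Collect_flip[where p = "\<lambda>y. f y = f (flip k x)"] ..
  moreover have "card (RP k Q (flip k x))
      = card {y \<in> inputs k. transcript Q (flip k y) = transcript Q (flip k x)}"
    unfolding RP_def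
      card_Collect_flip[where p = "\<lambda>y. transcript Q y = transcript Q (flip k x)"] ..
  ultimately show "ratio_obj k f Q (flip k x) = ratio_obj k g P x"
    using assms x by (simp add: ratio_obj_def RI_def RP_def cong: conj_cong)
  fix i
  have "card (RI_wrt i k f (flip k x))
      = card {y \<in> inputs k. f (flip k y) = f (flip k x) \<and> coord i (flip k y) = coord i (flip k x)}"
    unfolding RI_wrt_def RI_def mem_Collect_eq conj_assoc
      card_Collect_flip[where p = "\<lambda>y. f y = f (flip k x) \<and> coord i y = coord i (flip k x)"] ..
  moreover have "card (RP_wrt i k Q (flip k x))
      = card {y \<in> inputs k. transcript Q (flip k y) = transcript Q (flip k x)
          \<and> coord i (flip k y) = coord i (flip k x)}"
    unfolding RP_wrt_def RP_def mem_Collect_eq conj_assoc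
      card_Collect_flip[where p = "\<lambda>y. transcript Q y = transcript Q (flip k x)
          \<and> coord i y = coord i (flip k x)"] ..
  ultimately show "ratio_wrt i k f Q (flip k x) = ratio_wrt i k g P x"
    using assms x
    by (simp add: ratio_wrt_def RI_wrt_def RI_def RP_wrt_def RP_def coord_flip_eq_iff
        cong: conj_cong)
qed

text \<open>\<open>h\<close> renames outputs, so the decoder of \<open>P\<close> followed by
  \<open>h\<close> decodes the new protocol.\<close>

lemma flip_protocol_in_protocols_for:
  assumes "P \<in> protocols_for k g" and "\<And>x. x \<in> inputs k \<Longrightarrow> f (flip k x) = h (g x)"
  shows "flip_protocol k P \<in> protocols_for k f"
proof -
  obtain decode where dec: "\<And>x. x \<in> inputs k \<Longrightarrow>
      history P x \<noteq> [] \<and> decode (last_message (history P x)) = g x"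
    using assms(1) unfolding protocols_for_def by blast
  have "history (flip_protocol k P) x \<noteq> [] \<and>
      (h \<circ> decode) (last_message (history (flip_protocol k P) x)) = f x" if "x \<in> inputs k" for x
    using dec[OF flip_in_inputs[OF that]] assms(2)[OF flip_in_inputs[OF that]]
    by (simp add: history_flip_protocol flip_flip that)
  then show ?thesis
    unfolding protocols_for_def by blast
qed

lemma public_good_eq_Build_iff:
  "x \<in> inputs k \<Longrightarrow> public_good (cost k) x = Build \<longleftrightarrow> millionaires (flip k x) = Party1"
  by (cases x) (auto simp: flip.simps inputs_def cost_def)

lemma public_good_eq_iff:
  assumes "x \<in> inputs k" "y \<in> inputs k"
  shows "millionaires (flip k y) = millionaires (flip k x)
    \<longleftrightarrow> public_good (cost k) y = public_good (cost k) x"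
  using assms[THEN public_good_eq_Build_iff]
  by (cases "public_good (cost k) x"; cases "public_good (cost k) y";
      cases "millionaires (flip k x)"; cases "millionaires (flip k y)") simp_all

text \<open>As the flip is its own inverse on \<open>inputs k\<close>, \<open>flip_protocol\<close>
  provides the witness both here and in the converse direction.\<close>

lemma public_good_to_millionaires:
  assumes "P \<in> protocols_for k (public_good (cost k))"
  shows "\<exists>Q\<in>protocols_for k millionaires. same_privacy k millionaires Q (public_good (cost k)) P"
proof
  have "millionaires (flip k x)
      = (case public_good (cost k) x of Build \<Rightarrow> Party1 | Do_Not_Build \<Rightarrow> Party2)"
    if "x \<in> inputs k" for x
    using public_good_eq_Build_iff[OF that]
    by (cases "public_good (cost k) x"; cases "millionaires (flip k x)") simp_all
  with assms show "flip_protocol k P \<in> protocols_for k millionaires"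
    by (rule flip_protocol_in_protocols_for)
  show "same_privacy k millionaires (flip_protocol k P) (public_good (cost k)) P"
    by (rule same_privacyI)
      (simp_all add: transcript_def history_flip_protocol flip_flip public_good_eq_iff)
qed

lemma millionaires_to_public_good:
  assumes "Q \<in> protocols_for k millionaires"
  shows "\<exists>P\<in>protocols_for k (public_good (cost k)).
    same_privacy k millionaires Q (public_good (cost k)) P"
proof
  have "public_good (cost k) (flip k x)
      = (case millionaires x of Party1 \<Rightarrow> Build | Party2 \<Rightarrow> Do_Not_Build)"
    if "x \<in> inputs k" for x
    using public_good_eq_Build_iff[OF flip_in_inputs[OF that]] that
    by (cases "public_good (cost k) (flip k x)"; cases "millionaires x") (simp_all add: flip_flip)
  with assms show "flip_protocol k Q \<in> protocols_for k (public_good (cost k))"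
    by (rule flip_protocol_in_protocols_for)
  show "same_privacy k millionaires Q (public_good (cost k)) (flip_protocol k Q)"
    by (rule same_privacyI)
      (simp_all add: transcript_def history_flip_protocol flip_flip public_good_eq_iff)
qed

section \<open>Transfer from protocols to functions\<close>

text \<open>Protocols are matched in both directions, so the two infima range over the same set of
  reals. \<open>F\<close> and \<open>G\<close> are kept apart because averages use \<open>D\<close>
  on one side and its image under the flip on the other.\<close>

lemma min_PAR_eq:
  assumes "\<And>Q P. same_privacy k millionaires Q (public_good (cost k)) P \<Longrightarrow>
    F millionaires Q = G (public_good (cost k)) P"
  shows "min_PAR k (public_good (cost k)) G = min_PAR k millionaires F"
proof -
  have "G (public_good (cost k)) ` protocols_for k (public_good (cost k))
      = F millionaires ` protocols_for k millionaires"
  proof (intro subset_antisym image_subsetI)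
    fix P assume "P \<in> protocols_for k (public_good (cost k))"
    from public_good_to_millionaires[OF this]
    show "G (public_good (cost k)) P \<in> F millionaires ` protocols_for k millionaires"
      using assms by (metis imageI)
  next
    fix Q assume "Q \<in> protocols_for k millionaires"
    from millionaires_to_public_good[OF this]
    show "F millionaires Q
        \<in> G (public_good (cost k)) ` protocols_for k (public_good (cost k))"
      using assms by (metis imageI)
  qed
  then show ?thesis
    by (simp add: min_PAR_def)
qed

lemma Max_image_flip:
  assumes "\<And>x. x \<in> inputs k \<Longrightarrow> r (flip k x) = s x"
  shows "Max (r ` inputs k) = Max (s ` inputs k)"
proof -
  have "r ` inputs k = r ` flip k ` inputs k"
    using bij_betw_flip by (simp add: bij_betw_def)
  also have "\<dots> = s ` inputs k"
    using assms by (auto simp: image_image)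
  finally show ?thesis by simp
qed

lemma expectation_map_flip:
  assumes "\<And>x. x \<in> inputs k \<Longrightarrow> r (flip k x) = (s x :: real)" and "set_pmf D \<subseteq> inputs k"
  shows "measure_pmf.expectation (map_pmf (flip k) D) r = measure_pmf.expectation D s"
  unfolding integral_map_pmf
  by (rule integral_cong_AE) (use assms in \<open>auto simp: AE_measure_pmf_iff\<close>)

lemma worst_PAR_same_privacy:
  assumes "same_privacy k f Q g P"
  shows "worst_obj_PAR k f Q = worst_obj_PAR k g P"
    and "worst_PAR_wrt i k f Q = worst_PAR_wrt i k g P"
  unfolding worst_obj_PAR_def worst_PAR_wrt_def
  by (rule Max_image_flip; use assms in \<open>simp add: same_privacy_def\<close>)+

lemma avg_PAR_same_privacy:
  assumes "same_privacy k f Q g P" and "set_pmf D \<subseteq> inputs k"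
  shows "avg_obj_PAR k (map_pmf (flip k) D) f Q = avg_obj_PAR k D g P"
    and "avg_PAR_wrt i k (map_pmf (flip k) D) f Q = avg_PAR_wrt i k D g P"
  unfolding avg_obj_PAR_def avg_PAR_wrt_def
  by (rule expectation_map_flip; use assms in \<open>simp add: same_privacy_def\<close>)+

lemma map_pmf_flip_uniform: "map_pmf (flip k) (uniform k) = uniform k"
  using bij_betw_flip[of k] by (simp add: uniform_def map_pmf_of_set_bij_betw)

section \<open>Average ratio under the uniform distribution\<close>

text \<open>Every fibre of \<open>t\<close> contributes its size times the reciprocal of that size,
  namely 1.\<close>

lemma sum_inverse_card_fibre:
  assumes "finite A"
  shows "(\<Sum>x\<in>A. 1 / real (card {y \<in> A. t y = t x})) = real (card (t ` A))"
proof -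
  have "(\<Sum>x\<in>A. 1 / real (card {y \<in> A. t y = t x}))
      = (\<Sum>v\<in>t ` A. \<Sum>x\<in>{x \<in> A. t x = v}. 1 / real (card {y \<in> A. t y = t x}))"
    using assms by (rule sum.image_gen)
  also have "\<dots> = (\<Sum>v\<in>t ` A. 1)"
  proof (rule sum.cong[OF refl])
    fix v assume "v \<in> t ` A"
    then have "card {y \<in> A. t y = v} > 0"
      using assms by (auto simp: card_gt_0_iff)
    then show "(\<Sum>x\<in>{x \<in> A. t x = v}. 1 / real (card {y \<in> A. t y = t x})) = 1"
      by simp
  qed
  finally show ?thesis by simp
qed

lemma avg_obj_PAR_uniform:
  "avg_obj_PAR k (uniform k) f P = (\<Sum>x\<in>inputs k. ratio_obj k f P x) / (2 ^ k * 2 ^ k)"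
  by (simp add: avg_obj_PAR_def uniform_def integral_pmf_of_set card_inputs)

text \<open>Bounding \<open>RI k f x\<close> by the whole input set cancels the normalisation and
  leaves the sum of reciprocal class sizes.\<close>

lemma avg_obj_PAR_uniform_le:
  "avg_obj_PAR k (uniform k) f P \<le> real (card (transcript P ` inputs k))"
proof -
  have "ratio_obj k f P x \<le> 2 ^ k * 2 ^ k * (1 / real (card (RP k P x)))" for x
  proof -
    have "card (RI k f x) \<le> card (inputs k)"
      by (rule card_mono) (auto simp: RI_def)
    then have "real (card (RI k f x)) \<le> real (2 ^ k * 2 ^ k)"
      unfolding card_inputs of_nat_le_iff .
    then show ?thesis
      by (simp add: ratio_obj_def divide_right_mono)
  qed
  then have "(\<Sum>x\<in>inputs k. ratio_obj k f P x)
      \<le> (\<Sum>x\<in>inputs k. 2 ^ k * 2 ^ k * (1 / real (card (RP k P x))))"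
    by (rule sum_mono)
  also have "\<dots> = 2 ^ k * 2 ^ k * real (card (transcript P ` inputs k))"
    unfolding sum_distrib_left[symmetric] RP_def by (subst sum_inverse_card_fibre) simp_all
  finally show ?thesis
    by (simp add: avg_obj_PAR_uniform field_simps)
qed

section \<open>Lower bound for the Millionaires Problem\<close>

text \<open>The diagonal is a fooling set: ties go to party 1, whereas for \<open>x < y\<close> the
  mixed input \<open>(x, y)\<close> has output \<open>Party2\<close>.\<close>

lemma card_transcripts_Party1_ge:
  assumes "P \<in> protocols_for k millionaires"
  shows "2 ^ k \<le> card (transcript P ` {x \<in> inputs k. millionaires x = Party1})"
proof -
  have "inj_on (\<lambda>z. transcript P (z, z)) {0..2 ^ k - 1}"
  proof (rule linorder_inj_onI')
    fix x y :: nat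
    assume xy: "x \<in> {0..2 ^ k - 1}" "y \<in> {0..2 ^ k - 1}" "x < y"
    show "transcript P (x, x) \<noteq> transcript P (y, y)"
    proof
      assume eq: "transcript P (x, x) = transcript P (y, y)"
      then have "history P (x, y) = history P (x, x)"
        using history_rectangle history_eq_if_transcript_eq by metis
      then have "millionaires (x, y) = millionaires (x, x)"
        using output_eq_if_transcript_eq[OF assms, of "(x, y)" "(x, x)"] xy
        by (simp add: transcript_def inputs_def)
      with xy(3) show False by simp
    qed
  qed
  then have "2 ^ k = card ((\<lambda>z. transcript P (z, z)) ` {0..2 ^ k - 1})"
    by (simp add: card_image)
  also have "\<dots> \<le> card (transcript P ` {x \<in> inputs k. millionaires x = Party1})"
    by (rule card_mono) (auto simp: inputs_def)
  finally show ?thesis .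
qed

text \<open>Of an input and its swap, at least one has output \<open>Party1\<close>.\<close>

lemma card_Party1_ge: "2 ^ k * 2 ^ k \<le> 2 * card {x \<in> inputs k. millionaires x = Party1}"
proof -
  define A where "A = {x \<in> inputs k. millionaires x = Party1}"
  have fin: "finite A" by (simp add: A_def)
  have "inputs k \<subseteq> A \<union> prod.swap ` A"
  proof
    fix x assume "x \<in> inputs k"
    then have "x \<in> A \<or> prod.swap x \<in> A"
      by (cases x) (auto simp: A_def inputs_def)
    then show "x \<in> A \<union> prod.swap ` A"
      by (metis UnI1 UnI2 image_eqI swap_swap)
  qed
  then have "card (inputs k) \<le> card (A \<union> prod.swap ` A)"
    using fin by (intro card_mono) auto
  also have "\<dots> \<le> card A + card (prod.swap ` A)"
    by (rule card_Un_le)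
  also have "\<dots> \<le> 2 * card A"
    using card_image_le[OF fin, of prod.swap] by simp
  finally show ?thesis
    by (simp add: card_inputs A_def)
qed

text \<open>The inputs with output \<open>Party1\<close> suffice: there the ratios sum to the size
  of this region (at least half of all inputs) times its number of transcripts (at least
  \<open>2 ^ k\<close>).\<close>

lemma avg_obj_PAR_uniform_millionaires_ge:
  assumes "P \<in> protocols_for k millionaires"
  shows "2 ^ k / 2 \<le> avg_obj_PAR k (uniform k) millionaires P"
proof -
  define A where "A = {x \<in> inputs k. millionaires x = Party1}"
  have ratio: "ratio_obj k millionaires P x
      = real (card A) * (1 / real (card {y \<in> A. transcript P y = transcript P x}))"
    if "x \<in> A" for x
  proof -
    have "RI k millionaires x = A"
      using that by (auto simp: RI_def A_def)
    \<comment> \<open>Correctness keeps the whole transcript class of \<open>x\<close> inside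
      \<open>A\<close>, so it is a fibre over \<open>A\<close>.\<close>
    moreover have "RP k P x = {y \<in> A. transcript P y = transcript P x}"
      using that output_eq_if_transcript_eq[OF assms, of _ x] by (auto simp: RP_def A_def)
    ultimately show ?thesis
      by (simp add: ratio_obj_def)
  qed
  have "real (2 ^ k * 2 ^ k) \<le> real (2 * card A)"
    unfolding of_nat_le_iff A_def by (rule card_Party1_ge)
  moreover have "real (2 ^ k) \<le> real (card (transcript P ` A))"
    unfolding of_nat_le_iff A_def by (rule card_transcripts_Party1_ge[OF assms])
  ultimately have "(2 ^ k * 2 ^ k) / 2 * 2 ^ k \<le> real (card A) * real (card (transcript P ` A))"
    by (intro mult_mono) auto
  also have "\<dots> = (\<Sum>x\<in>A. ratio_obj k millionaires P x)"
    by (simp only: ratio sum_distrib_left[symmetric] cong: sum.cong)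
      (subst sum_inverse_card_fibre, simp_all add: A_def)
  \<comment> \<open>The remaining inputs contribute nonnegative terms.\<close>
  also have "\<dots> \<le> (\<Sum>x\<in>inputs k. ratio_obj k millionaires P x)"
    by (rule sum_mono2) (auto simp: A_def ratio_obj_def)
  finally show ?thesis
    by (simp add: avg_obj_PAR_uniform field_simps)
qed

section \<open>Upper bound by a linear scan\<close>

text \<open>
  Invariant: both inputs are at least \<open>i\<close>.  The constant last bit of party 1 announces the result.
\<close>

fun scan :: "nat \<Rightarrow> nat \<Rightarrow> protocol" where
  "scan 0 i = Send Party1 (\<lambda>_. True) (\<lambda>_. Halt)"
| "scan (Suc n) i = Send Party2 (\<lambda>x. x = i)
     (\<lambda>b. if b then Send Party1 (\<lambda>_. True) (\<lambda>_. Halt)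
       else Send Party1 (\<lambda>x. x = i)
         (\<lambda>b. if b then Send Party1 (\<lambda>_. False) (\<lambda>_. Halt) else scan n (Suc i)))"

lemma history_scan_nonempty [simp]: "history (scan n i) x \<noteq> []"
  by (cases n) auto

text \<open>The bound \<open>x2 < i + n\<close> guarantees a stop before \<open>scan 0\<close>,
  whose answer is arbitrary. Party 2 is asked first, so a tie is announced as a win of party
  1.\<close>

lemma last_history_scan:
  "i \<le> x1 \<Longrightarrow> i \<le> x2 \<Longrightarrow> x2 < i + n \<Longrightarrow>
    snd (last (history (scan n i) (x1, x2))) \<longleftrightarrow> millionaires (x1, x2) = Party1"
  by (induction n i rule: scan.induct) auto

lemma scan_in_protocols_for: "scan (2 ^ k) 0 \<in> protocols_for k millionaires"
proof -
  have "(\<lambda>m. if last m then Party1 else Party2) (last_message (history (scan (2 ^ k) 0) x))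
      = millionaires x" if "x \<in> inputs k" for x
  proof -
    obtain x1 x2 where x: "x = (x1, x2)" by (cases x)
    have "x2 \<le> 2 ^ k - 1"
      using that by (simp add: x inputs_def)
    also have "\<dots> < 2 ^ k" by simp
    finally show ?thesis
      using last_history_scan[of 0 x1 x2 "2 ^ k"]
      by (simp add: x last_last_message split: if_splits)
  qed
  then show ?thesis
    unfolding protocols_for_def mem_Collect_eq
    by (intro exI[of _ "\<lambda>m. if last m then Party1 else Party2"]) simp
qed

text \<open>Each round adds two ways to stop, and the base case adds one. Finiteness is carried
  through the induction because \<open>card\<close> of an infinite set is 0, which would make the
  bound meaningless.\<close>

lemma range_transcript_scan:
  "finite (range (transcript (scan n i))) \<and> card (range (transcript (scan n i))) \<le> 2 * n + 1"
proof (induction n arbitrary: i)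
  case 0
  have "range (transcript (scan 0 i)) = {[True]}"
    by (auto simp: transcript_def)
  then show ?case by simp
next
  case (Suc n)
  let ?T = "range (transcript (scan n (Suc i)))"
  \<comment> \<open>The branches of one round: party 2 stops, party 1 stops, or the scan goes
    on.\<close>
  let ?S = "insert [True, True] (insert [False, True, False] ((\<lambda>t. False # False # t) ` ?T))"
  have sub: "range (transcript (scan (Suc n) i)) \<subseteq> ?S"
    by (auto simp: transcript_def image_iff split: if_splits)
  have T: "finite ?T" "card ?T \<le> 2 * n + 1"
    using Suc.IH by auto
  have "card (range (transcript (scan (Suc n) i))) \<le> card ?S"
    using T(1) sub by (intro card_mono) auto
  also have "\<dots> \<le> Suc (Suc (card ((\<lambda>t. False # False # t) ` ?T)))"
    using T(1) by (simp add: card_insert_if)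
  also have "\<dots> \<le> Suc (Suc (2 * n + 1))"
    using card_image_le[OF T(1), of "\<lambda>t. False # False # t"] T(2) by simp
  finally show ?case
    using finite_subset[OF sub] T(1) by simp
qed

lemma fun_avg_obj_PAR_uniform_millionaires_bounds:
  "2 ^ k / 2 \<le> fun_avg_obj_PAR k (uniform k) millionaires"
  "fun_avg_obj_PAR k (uniform k) millionaires \<le> 3 * 2 ^ k"
proof -
  show "2 ^ k / 2 \<le> fun_avg_obj_PAR k (uniform k) millionaires"
    unfolding fun_avg_obj_PAR_def min_PAR_def
    using scan_in_protocols_for avg_obj_PAR_uniform_millionaires_ge
    by (intro cINF_greatest) auto
  have "fun_avg_obj_PAR k (uniform k) millionaires
      \<le> avg_obj_PAR k (uniform k) millionaires (scan (2 ^ k) 0)"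
    unfolding fun_avg_obj_PAR_def min_PAR_def
    \<comment> \<open>A real infimum lies below its members only if the set is bounded below; the
      lower bound just used supplies this.\<close>
    by (rule cINF_lower[OF _ scan_in_protocols_for])
      (use avg_obj_PAR_uniform_millionaires_ge in \<open>auto intro: bdd_belowI2[where m = "2 ^ k / 2"]\<close>)
  also have "\<dots> \<le> real (card (transcript (scan (2 ^ k) 0) ` inputs k))"
    by (rule avg_obj_PAR_uniform_le)
  also have "\<dots> \<le> real (card (range (transcript (scan (2 ^ k) 0))))"
    unfolding of_nat_le_iff using range_transcript_scan by (intro card_mono) auto
  also have "\<dots> \<le> real (2 * 2 ^ k + 1)"
    unfolding of_nat_le_iff using range_transcript_scan by blast
  \<comment> \<open>The extra 1 is absorbed by \<open>2 ^ k\<close>.\<close>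
  also have "\<dots> \<le> 3 * 2 ^ k"
    by simp
  finally show "fun_avg_obj_PAR k (uniform k) millionaires \<le> 3 * 2 ^ k" .
qed

section \<open>Conclusion for the public-good problem\<close>

lemma fun_avg_obj_PAR_public_good:
  assumes "set_pmf D \<subseteq> inputs k"
  shows "fun_avg_obj_PAR k D (public_good (cost k))
    = fun_avg_obj_PAR k (map_pmf (flip k) D) millionaires"
  unfolding fun_avg_obj_PAR_def by (rule min_PAR_eq) (rule avg_PAR_same_privacy[OF _ assms])

lemma fun_avg_obj_PAR_uniform_public_good:
  "fun_avg_obj_PAR k (uniform k) (public_good (cost k)) = fun_avg_obj_PAR k (uniform k) millionaires"
  using fun_avg_obj_PAR_public_good[of "uniform k" k]
  by (simp add: map_pmf_flip_uniform) (simp add: uniform_def)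

theorem mainTheorem6:
  shows
    "(\<forall>k.
       (\<forall>x1\<in>{0..2 ^ k - 1}. \<forall>x2\<in>{0..2 ^ k - 1}.
          cost k - x2 \<in> {0..2 ^ k - 1} \<and>
          (x1 + x2 \<ge> cost k \<longleftrightarrow> x1 \<ge> cost k - x2) \<and>
          (public_good (cost k) (x1, x2) = Build \<longleftrightarrow> millionaires (x1, cost k - x2) = Party1)) \<and>
       bij_betw (flip k) (inputs k) (inputs k) \<and>
       map_pmf (flip k) (uniform k) = uniform k \<and>
       (\<forall>P\<in>protocols_for k (public_good (cost k)). \<exists>Q\<in>protocols_for k millionaires.
          \<forall>x\<in>inputs k.
            transcript Q (flip k x) = transcript P x \<and>
            ratio_obj k millionaires Q (flip k x) = ratio_obj k (public_good (cost k)) P x \<and>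
            (\<forall>i. ratio_wrt i k millionaires Q (flip k x)
                   = ratio_wrt i k (public_good (cost k)) P x)) \<and>
       (\<forall>Q\<in>protocols_for k millionaires. \<exists>P\<in>protocols_for k (public_good (cost k)).
          \<forall>x\<in>inputs k.
            transcript P x = transcript Q (flip k x) \<and>
            ratio_obj k (public_good (cost k)) P x = ratio_obj k millionaires Q (flip k x) \<and>
            (\<forall>i. ratio_wrt i k (public_good (cost k)) P x
                   = ratio_wrt i k millionaires Q (flip k x))) \<and>
       fun_worst_obj_PAR k (public_good (cost k)) = fun_worst_obj_PAR k millionaires \<and>
       (\<forall>i. fun_worst_PAR_wrt i k (public_good (cost k)) = fun_worst_PAR_wrt i k millionaires) \<and>
       fun_worst_subj_PAR k (public_good (cost k)) = fun_worst_subj_PAR k millionaires \<and>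
       (\<forall>D. set_pmf D \<subseteq> inputs k \<longrightarrow>
          fun_avg_obj_PAR k D (public_good (cost k))
            = fun_avg_obj_PAR k (map_pmf (flip k) D) millionaires \<and>
          (\<forall>i. fun_avg_PAR_wrt i k D (public_good (cost k))
                 = fun_avg_PAR_wrt i k (map_pmf (flip k) D) millionaires) \<and>
          fun_avg_subj_PAR k D (public_good (cost k))
            = fun_avg_subj_PAR k (map_pmf (flip k) D) millionaires)) \<and>
     (\<exists>b::real. b > 1 \<and>
        (\<lambda>k. fun_avg_obj_PAR k (uniform k) (public_good (cost k))) \<in> \<Theta>(\<lambda>k. b ^ k))"
proof (intro conjI allI impI ballI)
  fix k x1 x2 :: nat
  assume "x1 \<in> {0..2 ^ k - 1}" "x2 \<in> {0..2 ^ k - 1}"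
  then show "cost k - x2 \<in> {0..2 ^ k - 1}"
    and "x1 + x2 \<ge> cost k \<longleftrightarrow> x1 \<ge> cost k - x2"
    and "public_good (cost k) (x1, x2) = Build \<longleftrightarrow> millionaires (x1, cost k - x2) = Party1"
    by (auto simp: cost_def)
next
  fix k P assume "P \<in> protocols_for k (public_good (cost k))"
  from public_good_to_millionaires[OF this]
  show "\<exists>Q\<in>protocols_for k millionaires.
          \<forall>x\<in>inputs k.
            transcript Q (flip k x) = transcript P x \<and>
            ratio_obj k millionaires Q (flip k x) = ratio_obj k (public_good (cost k)) P x \<and>
            (\<forall>i. ratio_wrt i k millionaires Q (flip k x)
                   = ratio_wrt i k (public_good (cost k)) P x)"
    by (simp only: same_privacy_def)
next
  fix k Q assume "Q \<in> protocols_for k millionaires"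
  then obtain P where "P \<in> protocols_for k (public_good (cost k))"
    "same_privacy k millionaires Q (public_good (cost k)) P"
    using millionaires_to_public_good by blast
  then show "\<exists>P\<in>protocols_for k (public_good (cost k)).
          \<forall>x\<in>inputs k.
            transcript P x = transcript Q (flip k x) \<and>
            ratio_obj k (public_good (cost k)) P x = ratio_obj k millionaires Q (flip k x) \<and>
            (\<forall>i. ratio_wrt i k (public_good (cost k)) P x
                   = ratio_wrt i k millionaires Q (flip k x))"
    by (intro bexI[of _ P]) (simp_all add: same_privacy_def)
next
  fix k
  show "fun_worst_obj_PAR k (public_good (cost k)) = fun_worst_obj_PAR k millionaires"
    unfolding fun_worst_obj_PAR_def by (rule min_PAR_eq) (rule worst_PAR_same_privacy)
  show "fun_worst_PAR_wrt i k (public_good (cost k)) = fun_worst_PAR_wrt i k millionaires" for i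
    unfolding fun_worst_PAR_wrt_def by (rule min_PAR_eq) (rule worst_PAR_same_privacy)
  show "fun_worst_subj_PAR k (public_good (cost k)) = fun_worst_subj_PAR k millionaires"
    unfolding fun_worst_subj_PAR_def
    by (rule min_PAR_eq) (simp only: worst_subj_PAR_def worst_PAR_same_privacy)
next
  fix k D assume D: "set_pmf D \<subseteq> inputs k"
  show "fun_avg_obj_PAR k D (public_good (cost k))
      = fun_avg_obj_PAR k (map_pmf (flip k) D) millionaires"
    using D by (rule fun_avg_obj_PAR_public_good)
  show "fun_avg_PAR_wrt i k D (public_good (cost k))
      = fun_avg_PAR_wrt i k (map_pmf (flip k) D) millionaires" for i
    unfolding fun_avg_PAR_wrt_def by (rule min_PAR_eq) (rule avg_PAR_same_privacy[OF _ D])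
  show "fun_avg_subj_PAR k D (public_good (cost k))
      = fun_avg_subj_PAR k (map_pmf (flip k) D) millionaires"
    unfolding fun_avg_subj_PAR_def
    by (rule min_PAR_eq) (simp only: avg_subj_PAR_def avg_PAR_same_privacy[OF _ D])
next
  \<comment> \<open>The base is 2; the constants 1/2 and 3 are those of the Millionaires bounds,
    which carry over because the flip preserves the uniform distribution.\<close>
  have "(\<lambda>k. fun_avg_obj_PAR k (uniform k) (public_good (cost k))) \<in> \<Theta>(\<lambda>k. 2 ^ k)"
  proof (rule bigthetaI')
    show "\<forall>\<^sub>F k in sequentially.
        1 / 2 * norm (2 ^ k :: real) \<le> norm (fun_avg_obj_PAR k (uniform k) (public_good (cost k))) \<and>
        norm (fun_avg_obj_PAR k (uniform k) (public_good (cost k))) \<le> 3 * norm (2 ^ k :: real)"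
    proof (intro always_eventually allI)
      fix k
      \<comment> \<open>Nonnegativity of the ratio removes the norm.\<close>
      have "0 \<le> (2 ^ k / 2 :: real)" by simp
      also note fun_avg_obj_PAR_uniform_millionaires_bounds(1)[of k]
      finally show "1 / 2 * norm (2 ^ k :: real)
            \<le> norm (fun_avg_obj_PAR k (uniform k) (public_good (cost k))) \<and>
          norm (fun_avg_obj_PAR k (uniform k) (public_good (cost k))) \<le> 3 * norm (2 ^ k :: real)"
        using fun_avg_obj_PAR_uniform_millionaires_bounds[of k]
        by (simp add: fun_avg_obj_PAR_uniform_public_good)
    qed
  qed simp_all
  then show "\<exists>b::real. b > 1 \<and>
      (\<lambda>k. fun_avg_obj_PAR k (uniform k) (public_good (cost k))) \<in> \<Theta>(\<lambda>k. b ^ k)"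
    by (intro exI[of _ 2]) simp
qed (fact bij_betw_flip map_pmf_flip_uniform)+

end
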